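(* For every integer $j$ and every $n\ge0$, the statistics $h_{2,0}$ and $a_2$ are equidistributed over $\mathcal{P}_j(n)$.
   Context: The $2$-core of a partition is obtained by repeatedly removing dominoes (rim hooks of length $2$) whose removal leaves a Young diagram until none remain; it is well defined, a staircase, of size $\binom{2j}{2}=j(2j-1)$ for a unique integer $j$. $\mathcal{P}_j(n)$ is the set of partitions of $n$ whose $2$-core has size $\binom{2j}{2}$. For a cell $v$, $a_v$ (arm length) is the number of cells to its right and $l_v$ (leg length) the number below it. $h_{2,0}(\mu)$ is the number of cells $v$ with $l_v=0$ and $2\mid a_v+1$. $a_2(\mu)$ is the largest part of $\mu$ occurring at least twice, $0$ if none. Two statistics are equidistributed over a set $S$ if for every $i$ they take the value $i$ on the same number of elements of $S$. *)

theory Defs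
  imports Complex_Main
begin

definition is_partition :: "nat list \<Rightarrow> bool" where
  "is_partition \<mu> \<longleftrightarrow> sorted_wrt (\<ge>) \<mu> \<and> 0 \<notin> set \<mu>"

definition partitions :: "nat \<Rightarrow> nat list set" where
  "partitions n = {\<mu>. is_partition \<mu> \<and> sum_list \<mu> = n}"

text \<open>Cells are pairs (row, column), both counted from 0, with rows going down
  (English convention).\<close>

definition diagram :: "nat list \<Rightarrow> (nat \<times> nat) set" where
  "diagram \<mu> = {(r, c). r < length \<mu> \<and> c < \<mu> ! r}"

definition arm :: "nat list \<Rightarrow> nat \<times> nat \<Rightarrow> nat" where
  "arm \<mu> v = card {w \<in> diagram \<mu>. fst w = fst v \<and> snd v < snd w}"

definition leg :: "nat list \<Rightarrow> nat \<times> nat \<Rightarrow> nat" where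
  "leg \<mu> v = card {w \<in> diagram \<mu>. snd w = snd v \<and> fst v < fst w}"

definition is_domino :: "(nat \<times> nat) set \<Rightarrow> bool" where
  "is_domino d \<longleftrightarrow> (\<exists>r c. d = {(r, c), (r, Suc c)} \<or> d = {(r, c), (Suc r, c)})"

definition removes_domino :: "nat list \<Rightarrow> nat list \<Rightarrow> bool" where
  "removes_domino \<mu> \<nu> \<longleftrightarrow> is_partition \<mu> \<and> is_partition \<nu> \<and>
     (\<exists>d. is_domino d \<and> d \<subseteq> diagram \<mu> \<and> diagram \<nu> = diagram \<mu> - d)"

text \<open>The 2-core as a relation: \<open>\<nu>\<close> is reached from \<open>\<mu>\<close> by successive domino removals and
  admits no further one. Every partition has exactly one such \<open>\<nu>\<close>, but no
  definition here depends on that fact.\<close>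

definition has_two_core :: "nat list \<Rightarrow> nat list \<Rightarrow> bool" where
  "has_two_core \<mu> \<nu> \<longleftrightarrow> removes_domino\<^sup>*\<^sup>* \<mu> \<nu> \<and> \<not> (\<exists>\<rho>. removes_domino \<nu> \<rho>)"

text \<open>The index \<open>j\<close> ranges over all integers, so the binomial coefficient is the generalized
  one.\<close>

definition partitions_core :: "int \<Rightarrow> nat \<Rightarrow> nat list set" where
  "partitions_core j n =
     {\<mu> \<in> partitions n. \<exists>\<nu>. has_two_core \<mu> \<nu> \<and> int (sum_list \<nu>) = (2 * j) gchoose 2}"

lemma gchoose_two_core_size: "(2 * j) gchoose 2 = j * (2 * j - 1)" for j :: int
  by (simp add: gbinomial_prod_rev numeral_2_eq_2)

definition h20 :: "nat list \<Rightarrow> nat" where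
  "h20 \<mu> = card {v \<in> diagram \<mu>. leg \<mu> v = 0 \<and> 2 dvd arm \<mu> v + 1}"

definition a2 :: "nat list \<Rightarrow> nat" where
  "a2 \<mu> = Max (insert 0 {k \<in> set \<mu>. 2 \<le> count_list \<mu> k})"

definition equidistributed_on :: "'a set \<Rightarrow> ('a \<Rightarrow> nat) \<Rightarrow> ('a \<Rightarrow> nat) \<Rightarrow> bool" where
  "equidistributed_on S f g \<longleftrightarrow> (\<forall>i. card {x \<in> S. f x = i} = card {x \<in> S. g x = i})"

text \<open>Finiteness ensures that the cardinalities compared by \<open>equidistributed_on\<close> are genuine
  counts.\<close>

lemma finite_partitions: "finite (partitions n)"
proof (rule finite_subset)
  show "partitions n \<subseteq> {xs. set xs \<subseteq> {..n} \<and> length xs \<le> n}"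
  proof
    fix xs assume "xs \<in> partitions n"
    then have s: "sum_list xs = n" and z: "0 \<notin> set xs"
      by (auto simp: partitions_def is_partition_def)
    have "length xs \<le> sum_list xs"
      using z by (induction xs) auto
    moreover have "set xs \<subseteq> {..n}"
      using s member_le_sum_list by fastforce
    ultimately show "xs \<in> {xs. set xs \<subseteq> {..n} \<and> length xs \<le> n}"
      using s by simp
  qed
qed (simp add: finite_lists_length_le)

lemma finite_partitions_core: "finite (partitions_core j n)"
  using finite_partitions by (simp add: partitions_core_def)

end

theory Submission
  imports Defs "HOL-Library.Multiset"
begin

text \<open>Write a partition as \<open>\<delta> \<union> \<kappa> \<union> \<kappa>\<close> with \<open>\<delta>\<close> having distinct parts. Then \<open>a2\<close> is the largest
  part of \<open>\<kappa>\<close>, whereas \<open>h20\<close> of the conjugate partition is the number of parts of \<open>\<kappa>\<close>. So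
  conjugating the whole partition and then only \<open>\<kappa>\<close> takes \<open>h20\<close> to \<open>a2\<close>. The 2-core is
  determined by the number of cells of even content minus that of cells of odd content. This
  difference is unchanged by conjugation, and it depends on \<open>\<delta>\<close> alone because two equal adjacent
  rows form a stack of vertical dominoes.\<close>

section \<open>Partitions and Young diagrams\<close>

text \<open>The default 0 past the last part makes membership in the diagram a single inequality and
  lets the last row be compared with its empty successor.\<close>

definition row :: "nat list \<Rightarrow> nat \<Rightarrow> nat" where
  "row \<mu> r = (if r < length \<mu> then \<mu> ! r else 0)"

lemma row_Nil [simp]: "row [] r = 0"
  and row_Cons_0 [simp]: "row (x # xs) 0 = x"
  and row_Cons_Suc [simp]: "row (x # xs) (Suc r) = row xs r"
  by (simp_all add: row_def)

lemma mem_diagram_iff: "(r, c) \<in> diagram \<mu> \<longleftrightarrow> c < row \<mu> r"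
  by (auto simp: diagram_def row_def)

lemma row_antimono:
  assumes "is_partition \<mu>" "r \<le> s"
  shows "row \<mu> s \<le> row \<mu> r"
proof (cases "r = s")
  case False
  with assms show ?thesis
    by (auto simp: row_def is_partition_def sorted_wrt_iff_nth_less)
qed simp

lemma row_pos_iff: "is_partition \<mu> \<Longrightarrow> 0 < row \<mu> r \<longleftrightarrow> r < length \<mu>"
  by (auto simp: row_def is_partition_def) (metis nth_mem gr0I)

lemma diagram_Nil [simp]: "diagram [] = {}"
  by (simp add: diagram_def)

lemma diagram_Cons:
  "diagram (x # xs) = Pair 0 ` {..<x} \<union> map_prod Suc id ` diagram xs"
proof (rule set_eqI, clarify)
  fix r c
  show "(r, c) \<in> diagram (x # xs) \<longleftrightarrow> (r, c) \<in> Pair 0 ` {..<x} \<union> map_prod Suc id ` diagram xs"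
  proof (cases r)
    case (Suc k)
    have "(Suc k, c) \<in> map_prod Suc id ` diagram xs \<longleftrightarrow> (k, c) \<in> diagram xs"
      by force
    with Suc show ?thesis
      by (auto simp: mem_diagram_iff)
  qed (auto simp: mem_diagram_iff)
qed

lemma finite_diagram [simp]: "finite (diagram \<mu>)"
  by (induction \<mu>) (auto simp: diagram_Cons)

lemma sum_diagram_Cons:
  "sum f (diagram (x # xs)) = (\<Sum>c<x. f (0, c)) + (\<Sum>v\<in>diagram xs. f (Suc (fst v), snd v))"
proof -
  have "sum f (diagram (x # xs)) = sum f (Pair 0 ` {..<x}) + sum f (map_prod Suc id ` diagram xs)"
    unfolding diagram_Cons by (rule sum.union_disjoint) auto
  also have "sum f (Pair 0 ` {..<x}) = (\<Sum>c<x. f (0, c))"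
    by (subst sum.reindex) (auto simp: inj_on_def)
  also have "sum f (map_prod Suc id ` diagram xs) = (\<Sum>v\<in>diagram xs. f (Suc (fst v), snd v))"
    by (subst sum.reindex) (auto simp: inj_on_def intro!: sum.cong)
  finally show ?thesis .
qed

lemma card_diagram: "card (diagram \<mu>) = sum_list \<mu>"
proof (induction \<mu>)
  case (Cons x xs)
  have "(\<Sum>v\<in>diagram (x # xs). 1) = x + card (diagram xs)"
    by (subst sum_diagram_Cons) simp
  with Cons show ?case
    by simp
qed simp

text \<open>The diagram determines every row, and since parts are positive the rows determine the
  length.\<close>

lemma partition_eqI:
  assumes "is_partition \<mu>" "is_partition \<nu>" "diagram \<mu> = diagram \<nu>"
  shows "\<mu> = \<nu>"
proof -
  have "row \<mu> r = row \<nu> r" for r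
    using assms(3) mem_diagram_iff[of r _ \<mu>] mem_diagram_iff[of r _ \<nu>]
    by (metis linorder_neq_iff)
  moreover from this have "length \<mu> = length \<nu>"
    using assms row_pos_iff by (metis linorder_neq_iff)
  ultimately show ?thesis
    by (intro nth_equalityI) (auto simp: row_def, metis)
qed

section \<open>Young diagrams as finite down-closed sets of cells\<close>

definition down_closed :: "(nat \<times> nat) set \<Rightarrow> bool" where
  "down_closed Y \<longleftrightarrow> (\<forall>r c r' c'. (r, c) \<in> Y \<longrightarrow> r' \<le> r \<longrightarrow> c' \<le> c \<longrightarrow> (r', c') \<in> Y)"

lemma down_closed_diagram: "is_partition \<mu> \<Longrightarrow> down_closed (diagram \<mu>)"
  unfolding down_closed_def mem_diagram_iff
  by (meson row_antimono le_less_trans less_le_trans)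

text \<open>Inverse of \<open>diagram\<close> on finite down-closed sets: column 0 counts the rows,
  and the cardinality of each row is the corresponding part.\<close>

definition of_diagram :: "(nat \<times> nat) set \<Rightarrow> nat list" where
  "of_diagram Y = map (\<lambda>r. card {c. (r, c) \<in> Y}) [0..<card {r. (r, 0) \<in> Y}]"

text \<open>Turns the cardinalities in \<open>of_diagram\<close> back into membership: it is applied
  to each row and to the first column of a down-closed set.\<close>

lemma mem_initial_segment_iff:
  fixes S :: "nat set"
  assumes "finite S" "\<And>x y. x \<in> S \<Longrightarrow> y \<le> x \<Longrightarrow> y \<in> S"
  shows "x \<in> S \<longleftrightarrow> x < card S"
proof
  assume "x \<in> S"
  then have "{..x} \<subseteq> S"
    using assms by auto
  then have "card {..x} \<le> card S"
    using assms by (intro card_mono)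
  then show "x < card S"
    by simp
next
  assume "x < card S"
  show "x \<in> S"
  proof (rule ccontr)
    assume "x \<notin> S"
    then have "S \<subseteq> {..<x}"
      using assms by (metis lessThan_iff linorder_not_less subsetI)
    then have "card S \<le> card {..<x}"
      by (intro card_mono) auto
    with \<open>x < card S\<close> show False
      by simp
  qed
qed

lemma of_diagram:
  assumes "finite Y" "down_closed Y"
  shows "is_partition (of_diagram Y)" and "diagram (of_diagram Y) = Y"
proof -
  have fr: "finite {c. (r, c) \<in> Y}" for r
    by (rule finite_subset[of _ "snd ` Y"]) (use assms in \<open>force+\<close>)
  have fc: "finite {r. (r, 0) \<in> Y}"
    by (rule finite_subset[of _ "fst ` Y"]) (use assms in \<open>force+\<close>)
  have r: "(r, c) \<in> Y \<longleftrightarrow> c < card {c. (r, c) \<in> Y}" for r c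
    using mem_initial_segment_iff[OF fr, of r c] assms(2) unfolding down_closed_def by blast
  have c: "(r, 0) \<in> Y \<longleftrightarrow> r < card {r. (r, 0) \<in> Y}" for r
    using mem_initial_segment_iff[OF fc, of r] assms(2) unfolding down_closed_def by blast
  show "diagram (of_diagram Y) = Y"
  proof (rule set_eqI, clarify)
    fix a b
    have "(a, b) \<in> Y \<Longrightarrow> (a, 0) \<in> Y"
      using assms(2) unfolding down_closed_def by blast
    moreover have "(a, b) \<in> diagram (of_diagram Y) \<longleftrightarrow>
        a < card {r. (r, 0) \<in> Y} \<and> b < card {c. (a, c) \<in> Y}"
      by (auto simp: diagram_def of_diagram_def)
    ultimately show "(a, b) \<in> diagram (of_diagram Y) \<longleftrightarrow> (a, b) \<in> Y"
      using r[of a b] c[of a] by blast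
  qed
  have "card {c. (s, c) \<in> Y} \<le> card {c. (r, c) \<in> Y}" if "r \<le> s" for r s
    using assms(2) that by (intro card_mono fr) (auto simp: down_closed_def)
  moreover have "0 < card {c. (s, c) \<in> Y}" if "s < card {r. (r, 0) \<in> Y}" for s
    using r[of s 0] c[of s] that by blast
  ultimately show "is_partition (of_diagram Y)"
    by (fastforce simp: is_partition_def of_diagram_def sorted_wrt_iff_nth_less)
qed

section \<open>Conjugation of partitions\<close>

definition conjugate :: "nat list \<Rightarrow> nat list" where
  "conjugate \<mu> = of_diagram (prod.swap ` diagram \<mu>)"

lemma
  assumes "is_partition \<mu>"
  shows is_partition_conjugate: "is_partition (conjugate \<mu>)"
    and diagram_conjugate: "diagram (conjugate \<mu>) = prod.swap ` diagram \<mu>"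
proof -
  have "down_closed (prod.swap ` diagram \<mu>)"
    using down_closed_diagram[OF assms] unfolding down_closed_def by force
  then show "is_partition (conjugate \<mu>)" "diagram (conjugate \<mu>) = prod.swap ` diagram \<mu>"
    using of_diagram[of "prod.swap ` diagram \<mu>"] by (auto simp: conjugate_def)
qed

lemma mem_diagram_conjugate_iff:
  "is_partition \<mu> \<Longrightarrow> (r, c) \<in> diagram (conjugate \<mu>) \<longleftrightarrow> (c, r) \<in> diagram \<mu>"
  by (force simp: diagram_conjugate)

lemma conjugate_conjugate: "is_partition \<mu> \<Longrightarrow> conjugate (conjugate \<mu>) = \<mu>"
  by (rule partition_eqI)
     (simp_all add: is_partition_conjugate diagram_conjugate image_comp)

lemma sum_list_conjugate: "is_partition \<mu> \<Longrightarrow> sum_list (conjugate \<mu>) = sum_list \<mu>"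
  by (simp add: diagram_conjugate card_image flip: card_diagram)

lemma length_conjugate:
  assumes "is_partition \<mu>"
  shows "length (conjugate \<mu>) = row \<mu> 0"
proof -
  have "r < length (conjugate \<mu>) \<longleftrightarrow> r < row \<mu> 0" for r
    using mem_diagram_conjugate_iff[OF assms, of r 0] row_pos_iff[OF is_partition_conjugate[OF assms]]
    by (simp add: mem_diagram_iff)
  then show ?thesis
    by (metis linorder_neq_iff)
qed

lemma count_list_eq_card: "count_list xs x = card {i. i < length xs \<and> xs ! i = x}"
  by (simp add: count_list_eq_length_filter length_filter_conv_card eq_commute)

text \<open>The parts of the conjugate are the column heights. Column \<open>c\<close> has height
  \<open>Suc r\<close> exactly when row \<open>r\<close> reaches it and row \<open>Suc r\<close>
  does not.\<close>

lemma count_list_conjugate: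
  assumes "is_partition \<mu>"
  shows "count_list (conjugate \<mu>) (Suc r) = row \<mu> r - row \<mu> (Suc r)"
proof -
  have "(c < length (conjugate \<mu>) \<and> conjugate \<mu> ! c = Suc r) \<longleftrightarrow> row (conjugate \<mu>) c = Suc r" for c
    by (auto simp: row_def)
  also have "\<dots> c \<longleftrightarrow> (c, r) \<in> diagram (conjugate \<mu>) \<and> (c, Suc r) \<notin> diagram (conjugate \<mu>)" for c
    by (auto simp: mem_diagram_iff)
  also have "\<dots> c \<longleftrightarrow> c \<in> {row \<mu> (Suc r)..<row \<mu> r}" for c
    unfolding mem_diagram_conjugate_iff[OF assms] by (auto simp: mem_diagram_iff)
  finally have "{c. c < length (conjugate \<mu>) \<and> conjugate \<mu> ! c = Suc r} =
      {row \<mu> (Suc r)..<row \<mu> r}"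
    by blast
  then show ?thesis
    by (simp add: count_list_eq_card)
qed

section \<open>The index of the 2-core\<close>

text \<open>Normalised so that a 2-core with this value \<open>j\<close> has size \<open>j (2j - 1)\<close>.\<close>

definition core_index :: "nat list \<Rightarrow> int" where
  "core_index \<mu> = (\<Sum>v\<in>diagram \<mu>. (- 1) ^ (fst v + snd v))"

lemma core_index_conjugate: "is_partition \<mu> \<Longrightarrow> core_index (conjugate \<mu>) = core_index \<mu>"
  by (simp add: core_index_def diagram_conjugate sum.reindex add.commute)

lemma alternating_sum: "(\<Sum>c<x. (- 1) ^ c) = int (x mod 2)"
proof (induction x)
  case (Suc x)
  then show ?case
    by (cases "even x") (auto simp: even_iff_mod_2_eq_zero odd_iff_mod_2_eq_one mod_Suc)
qed simp

lemma core_index_Nil [simp]: "core_index [] = 0"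
  by (simp add: core_index_def)

text \<open>Deleting the first row moves all other cells up by one, which flips their signs; the
  first row itself contributes an alternating sum.\<close>

lemma core_index_Cons [simp]: "core_index (x # xs) = int (x mod 2) - core_index xs"
  by (simp add: core_index_def sum_diagram_Cons alternating_sum sum_negf)

text \<open>The two cells of a domino are adjacent and so carry opposite signs. The drop in size is
  the measure that makes repeated removal terminate.\<close>

lemma removes_domino_invariant:
  assumes "removes_domino \<mu> \<nu>"
  shows "core_index \<nu> = core_index \<mu>" and "sum_list \<nu> < sum_list \<mu>"
proof -
  obtain d where d: "is_domino d" "d \<subseteq> diagram \<mu>" "diagram \<nu> = diagram \<mu> - d"
    using assms by (auto simp: removes_domino_def)
  have "(\<Sum>v\<in>d. (- 1) ^ (fst v + snd v)) = (0 :: int)"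
    using d(1) by (auto simp: is_domino_def)
  with d show "core_index \<nu> = core_index \<mu>"
    by (simp add: core_index_def sum_diff)
  have "diagram \<nu> \<subset> diagram \<mu>"
    using d by (auto simp: is_domino_def)
  then show "sum_list \<nu> < sum_list \<mu>"
    by (simp add: psubset_card_mono flip: card_diagram)
qed

lemma ex_two_core:
  assumes "is_partition \<mu>"
  shows "\<exists>\<nu>. has_two_core \<mu> \<nu>"
  using assms
proof (induction "sum_list \<mu>" arbitrary: \<mu> rule: less_induct)
  case less
  show ?case
  proof (cases "\<exists>\<rho>. removes_domino \<mu> \<rho>")
    case True
    then obtain \<rho> where \<rho>: "removes_domino \<mu> \<rho>" ..
    then obtain \<nu> where "has_two_core \<rho> \<nu>"
      using less.hyps[OF removes_domino_invariant(2)[OF \<rho>]] by (auto simp: removes_domino_def)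
    with \<rho> have "has_two_core \<mu> \<nu>"
      by (auto simp: has_two_core_def intro: converse_rtranclp_into_rtranclp)
    then show ?thesis
      by blast
  qed (auto simp: has_two_core_def)
qed

lemma has_two_core_invariant:
  assumes "has_two_core \<mu> \<nu>" "is_partition \<mu>"
  shows "core_index \<nu> = core_index \<mu>" and "is_partition \<nu>"
proof -
  have "removes_domino\<^sup>*\<^sup>* \<mu> \<nu>"
    using assms by (simp add: has_two_core_def)
  then have "core_index \<nu> = core_index \<mu> \<and> is_partition \<nu>"
    using assms(2)
  proof (induction rule: rtranclp_induct)
    case (step \<rho> \<sigma>)
    then show ?case
      using removes_domino_invariant(1)[OF step.hyps(2)] by (simp add: removes_domino_def)
  qed simp
  then show "core_index \<nu> = core_index \<mu>" "is_partition \<nu>"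
    by simp_all
qed

section \<open>Partitions without removable dominoes\<close>

lemma removes_dominoI:
  assumes "is_partition \<mu>" "is_domino d" "d \<subseteq> diagram \<mu>" "down_closed (diagram \<mu> - d)"
  shows "\<exists>\<rho>. removes_domino \<mu> \<rho>"
  using of_diagram[OF _ assms(4)] assms unfolding removes_domino_def by auto

text \<open>This forces a 2-core to be a staircase. A drop of at least 2 after row \<open>r\<close>
  frees a horizontal domino at its end; two equal nonempty rows lead to a vertical one.\<close>

lemma row_step_of_domino_free:
  assumes p: "is_partition \<nu>" and free: "\<not> (\<exists>\<rho>. removes_domino \<nu> \<rho>)" and pos: "0 < row \<nu> r"
  shows "row \<nu> r = Suc (row \<nu> (Suc r))"
proof -
  have anti: "row \<nu> b \<le> row \<nu> a" if "a \<le> b" for a b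
    using row_antimono[OF p that] .
  have "row \<nu> r \<le> Suc (row \<nu> (Suc r))"
  proof (rule ccontr)
    assume big: "\<not> ?thesis"
    define c where "c = row \<nu> r - 2"
    have c: "row \<nu> r = Suc (Suc c)"
      using big by (simp add: c_def)
    let ?d = "{(r, c), (r, Suc c)}"
    have "down_closed (diagram \<nu> - ?d)"
      unfolding down_closed_def
    proof (intro allI impI)
      fix a b a' b'
      assume *: "(a, b) \<in> diagram \<nu> - ?d" "a' \<le> a" "b' \<le> b"
      then have "(a', b') \<in> diagram \<nu>"
        using down_closed_diagram[OF p] unfolding down_closed_def by blast
      moreover have "(a', b') \<notin> ?d"
      proof
        assume **: "(a', b') \<in> ?d"
        \<comment> \<open>A surviving cell weakly below and to the right of the domino would lie in
          row \<open>r\<close>, hence in the domino, or in a later row, all of which have length at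
          most \<open>c\<close>.\<close>
        then have "a = r \<or> row \<nu> a \<le> row \<nu> (Suc r)"
          by (cases "a \<le> r") (use * anti[of "Suc r" a] in auto)
        with * ** big c show False
          by (auto simp: mem_diagram_iff)
      qed
      ultimately show "(a', b') \<in> diagram \<nu> - ?d"
        by blast
    qed
    moreover have "?d \<subseteq> diagram \<nu>" "is_domino ?d"
      by (auto simp: mem_diagram_iff c is_domino_def)
    ultimately show False
      using removes_dominoI[OF p] free by blast
  qed
  moreover have "row \<nu> r \<noteq> row \<nu> (Suc r)"
  proof
    assume eq: "row \<nu> r = row \<nu> (Suc r)"
    \<comment> \<open>Rows \<open>r\<close> and \<open>Suc r\<close> may be followed by further
      equal rows that block the domino. The last repetition \<open>s\<close> of a nonempty row is
      taken instead, so that row \<open>s + 2\<close> is strictly shorter.\<close>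
    define P where "P s \<longleftrightarrow> 0 < row \<nu> s \<and> row \<nu> s = row \<nu> (Suc s)" for s
    have bound: "\<forall>s. P s \<longrightarrow> s \<le> length \<nu>"
      using row_pos_iff[OF p] by (auto simp: P_def)
    have "P r"
      using eq pos by (simp add: P_def)
    define s where "s = Greatest P"
    have "P s"
      unfolding s_def by (rule GreatestI_nat[of P, OF \<open>P r\<close>]) (use bound in blast)
    have "\<not> P (Suc s)"
      unfolding s_def using Greatest_le_nat[of P "Suc (Greatest P)" "length \<nu>"] bound by auto
    with \<open>P s\<close> have less: "row \<nu> (Suc (Suc s)) < row \<nu> s"
      using anti[of "Suc s" "Suc (Suc s)"] by (auto simp: P_def)
    define c where "c = row \<nu> s - 1"
    have c: "row \<nu> s = Suc c" "row \<nu> (Suc s) = Suc c"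
      using \<open>P s\<close> by (auto simp: c_def P_def)
    let ?d = "{(s, c), (Suc s, c)}"
    have "down_closed (diagram \<nu> - ?d)"
      unfolding down_closed_def
    proof (intro allI impI)
      fix a b a' b'
      assume *: "(a, b) \<in> diagram \<nu> - ?d" "a' \<le> a" "b' \<le> b"
      then have "(a', b') \<in> diagram \<nu>"
        using down_closed_diagram[OF p] unfolding down_closed_def by blast
      moreover have "(a', b') \<notin> ?d"
      proof
        assume **: "(a', b') \<in> ?d"
        then have "a = s \<or> a = Suc s \<or> row \<nu> a \<le> row \<nu> (Suc (Suc s))"
          by (cases "a \<le> Suc s") (use * anti[of "Suc (Suc s)" a] in auto)
        with * ** less c show False
          by (auto simp: mem_diagram_iff)
      qed
      ultimately show "(a', b') \<in> diagram \<nu> - ?d"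
        by blast
    qed
    moreover have "?d \<subseteq> diagram \<nu>" "is_domino ?d"
      by (auto simp: mem_diagram_iff c is_domino_def)
    ultimately show False
      using removes_dominoI[OF p] free by blast
  qed
  ultimately show ?thesis
    using anti[of r "Suc r"] by simp
qed

text \<open>The hypothesis forces the rows k, k-1, ..., 1. Peeling off the first one replaces the
  index j of the smaller staircase by (k mod 2) - j. Everything is doubled to avoid
  division.\<close>

lemma staircase_core_index_size:
  assumes "\<And>r. r < length \<nu> \<Longrightarrow> row \<nu> r = Suc (row \<nu> (Suc r))"
  shows "2 * core_index \<nu> = (if even (length \<nu>) then - int (length \<nu>) else int (length \<nu>) + 1)"
    and "2 * sum_list \<nu> = length \<nu> * (length \<nu> + 1)"
proof -
  \<comment> \<open>The conjunct on row 0 strengthens the induction: it identifies the head of the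
    list.\<close>
  have "row \<nu> 0 = length \<nu> \<and>
    2 * core_index \<nu> = (if even (length \<nu>) then - int (length \<nu>) else int (length \<nu>) + 1) \<and>
    2 * sum_list \<nu> = length \<nu> * (length \<nu> + 1)"
    using assms
  proof (induction \<nu>)
    case (Cons x xs)
    have "row xs r = Suc (row xs (Suc r))" if "r < length xs" for r
      using Cons.prems[of "Suc r"] that by simp
    note IH = Cons.IH[OF this]
    have x: "x = Suc (length xs)"
      using Cons.prems[of 0] IH by simp
    show ?case
      using IH by (auto simp: x algebra_simps mod_Suc even_iff_mod_2_eq_zero
        odd_iff_mod_2_eq_one)
  qed simp
  then show "2 * core_index \<nu> = (if even (length \<nu>) then - int (length \<nu>) else int (length \<nu>) + 1)"
    "2 * sum_list \<nu> = length \<nu> * (length \<nu> + 1)"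
    by simp_all
qed

text \<open>With k rows in the core, D = 2j is -k or k+1 depending on parity, and both values
  satisfy D(D-1) = k(k+1), twice the size of the core.\<close>

lemma two_core_size:
  assumes "has_two_core \<mu> \<nu>" "is_partition \<mu>"
  shows "int (sum_list \<nu>) = core_index \<mu> * (2 * core_index \<mu> - 1)"
proof -
  note \<nu> = has_two_core_invariant[OF assms]
  have "row \<nu> r = Suc (row \<nu> (Suc r))" if "r < length \<nu>" for r
    using row_step_of_domino_free[OF \<nu>(2)] assms(1) row_pos_iff[OF \<nu>(2)] that
    by (simp add: has_two_core_def)
  note st = staircase_core_index_size[OF this]
  let ?D = "2 * core_index \<nu>" and ?k = "int (length \<nu>)"
  have "D * (D - 1) = k * (k + 1)" if "D = - k \<or> D = k + 1" for D k :: int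
    using that by (auto simp: algebra_simps)
  then have "?D * (?D - 1) = ?k * (?k + 1)"
    using st(1) by metis
  moreover have "2 * int (sum_list \<nu>) = ?k * (?k + 1)"
    using arg_cong[OF st(2), of int] by (simp add: algebra_simps)
  ultimately show ?thesis
    using \<nu>(1) by simp
qed

text \<open>Replaces the 2-core by an invariant computed directly from the partition. It suffices
  that j(2j-1) determines the integer j.\<close>

lemma partitions_core_eq: "partitions_core j n = {\<mu> \<in> partitions n. core_index \<mu> = j}"
proof -
  have "(\<exists>\<nu>. has_two_core \<mu> \<nu> \<and> int (sum_list \<nu>) = (2 * j) gchoose 2) \<longleftrightarrow> core_index \<mu> = j"
    if "is_partition \<mu>" for \<mu>
  proof -
    have "(\<exists>\<nu>. has_two_core \<mu> \<nu> \<and> int (sum_list \<nu>) = (2 * j) gchoose 2) \<longleftrightarrow>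
        core_index \<mu> * (2 * core_index \<mu> - 1) = j * (2 * j - 1)"
      unfolding gchoose_two_core_size of_int_eq_iff
      using ex_two_core[OF that] two_core_size[OF _ that] by metis
    also have "\<dots> \<longleftrightarrow> (core_index \<mu> - j) * (2 * (core_index \<mu> + j) - 1) = 0"
      by (simp add: algebra_simps)
    \<comment> \<open>The second factor is odd, hence nonzero.\<close>
    also have "\<dots> \<longleftrightarrow> core_index \<mu> = j"
      by (auto, presburger)
    finally show ?thesis .
  qed
  then show ?thesis
    by (auto simp: partitions_core_def partitions_def)
qed

section \<open>Splitting off pairs of equal parts\<close>

text \<open>On a sorted list equal parts are adjacent, so cancelling neighbouring pairs leaves
  \<delta>; \<open>half\<close> below keeps one part of each cancelled pair and yields
  \<kappa>.\<close>

fun reduced :: "nat list \<Rightarrow> nat list" where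
  "reduced (x # y # zs) = (if x = y then reduced zs else x # reduced (y # zs))"
| "reduced xs = xs"

fun half :: "nat list \<Rightarrow> nat list" where
  "half (x # y # zs) = (if x = y then x # half zs else half (y # zs))"
| "half xs = []"

lemma mset_reduced_half: "mset xs = mset (reduced xs) + mset (half xs) + mset (half xs)"
  by (induction xs rule: reduced.induct) auto

lemma set_reduced_subset: "set (reduced xs) \<subseteq> set xs"
  by (induction xs rule: reduced.induct) auto

lemma set_half_subset: "set (half xs) \<subseteq> set xs"
  by (induction xs rule: half.induct) auto

text \<open>Two equal consecutive rows cancel in the recursion for \<open>core_index\<close>, and
  the sign of the rows after them is flipped twice.\<close>

lemma core_index_reduced: "core_index (reduced xs) = core_index xs"
  by (induction xs rule: reduced.induct) auto

lemma sorted_reduced: "sorted_wrt (\<ge>) xs \<Longrightarrow> sorted_wrt (>) (reduced xs)"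
proof (induction xs rule: reduced.induct)
  case (1 x y zs)
  show ?case
  proof (cases "x = y")
    case False
    then have "x > z" if "z \<in> set (reduced (y # zs))" for z
      using 1(3) set_reduced_subset[of "y # zs"] that by fastforce
    with 1 False show ?thesis
      by auto
  qed (use 1 in auto)
qed auto

lemma sorted_half: "sorted_wrt (\<ge>) xs \<Longrightarrow> sorted_wrt (\<ge>) (half xs)"
proof (induction xs rule: half.induct)
  case (1 x y zs)
  then show ?case
    using set_half_subset[of zs] by auto
qed auto

lemma count_list_strict_sorted:
  assumes "sorted_wrt (>) (xs :: nat list)"
  shows "count_list xs x \<le> 1"
  using assms by (induction xs) (auto simp: count_list_0_iff)

text \<open>Each multiplicity is d + 2h with d at most 1, so d and h are its remainder and quotient
  modulo 2.\<close>

lemma count_list_reduced_half: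
  assumes "sorted_wrt (\<ge>) xs"
  shows "count_list (reduced xs) x = count_list xs x mod 2"
    and "count_list (half xs) x = count_list xs x div 2"
proof -
  have "count_list xs x = count_list (reduced xs) x + 2 * count_list (half xs) x"
    using arg_cong[OF mset_reduced_half[of xs], of "\<lambda>M. count M x"] by (simp add: count_mset)
  moreover have "count_list (reduced xs) x \<le> 1"
    using assms by (intro count_list_strict_sorted sorted_reduced)
  ultimately show "count_list (reduced xs) x = count_list xs x mod 2"
    and "count_list (half xs) x = count_list xs x div 2"
    by simp_all
qed

lemma sorted_desc_eqI:
  fixes xs ys :: "nat list"
  assumes "sorted_wrt (\<ge>) xs" "sorted_wrt (\<ge>) ys" "\<And>x. count_list xs x = count_list ys x"
  shows "xs = ys"
proof -
  have "mset xs = mset ys"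
    using assms(3) by (intro multiset_eqI) (simp add: count_mset)
  moreover have "sorted (rev xs)" "sorted (rev ys)"
    using assms(1,2) by (simp_all add: sorted_wrt_rev)
  ultimately have "rev xs = rev ys"
    by (metis mset_rev properties_for_sort)
  then show ?thesis
    by simp
qed

lemma is_partition_half: "is_partition \<mu> \<Longrightarrow> is_partition (half \<mu>)"
  using sorted_half set_half_subset by (auto simp: is_partition_def)

text \<open>Passes from (\<delta>, \<kappa>) to (\<delta>, \<kappa>'), with \<kappa>' the conjugate
  of \<kappa>. Sorting merges the pieces into a partition; later arguments only use
  multiplicities.\<close>

definition conjugate_half :: "nat list \<Rightarrow> nat list" where
  "conjugate_half \<mu> =
     rev (sort (reduced \<mu> @ conjugate (half \<mu>) @ conjugate (half \<mu>)))"

lemma is_partition_conjugate_half: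
  assumes "is_partition \<mu>"
  shows "is_partition (conjugate_half \<mu>)"
  using is_partition_conjugate[OF is_partition_half[OF assms]] assms set_reduced_subset[of \<mu>]
  by (auto simp: is_partition_def conjugate_half_def sorted_wrt_rev)

lemma count_list_conjugate_half:
  "count_list (conjugate_half \<mu>) x =
     count_list (reduced \<mu>) x + 2 * count_list (conjugate (half \<mu>)) x"
  by (simp add: conjugate_half_def flip: count_mset)

text \<open>Multiplicities in \<delta> are at most 1, so remainder and quotient modulo 2 recover
  \<delta> and \<kappa>' from the merged list, even when the two share parts.\<close>

lemma
  assumes "is_partition \<mu>"
  shows half_conjugate_half: "half (conjugate_half \<mu>) = conjugate (half \<mu>)"
    and reduced_conjugate_half: "reduced (conjugate_half \<mu>) = reduced \<mu>"
proof -
  have s: "sorted_wrt (\<ge>) \<mu>" "sorted_wrt (\<ge>) (conjugate_half \<mu>)"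
      "sorted_wrt (\<ge>) (conjugate (half \<mu>))"
    using assms is_partition_conjugate_half[OF assms]
      is_partition_conjugate[OF is_partition_half[OF assms]]
    by (simp_all add: is_partition_def)
  have le: "count_list (reduced \<mu>) x \<le> 1" for x
    using s(1) by (intro count_list_strict_sorted sorted_reduced)
  have weak: "sorted_wrt (\<ge>) (reduced xs)" if "sorted_wrt (\<ge>) xs" for xs
    using sorted_reduced[OF that] by (rule sorted_wrt_mono_rel[rotated]) simp
  show "half (conjugate_half \<mu>) = conjugate (half \<mu>)"
  proof (rule sorted_desc_eqI[OF sorted_half[OF s(2)] s(3)])
    show "count_list (half (conjugate_half \<mu>)) x = count_list (conjugate (half \<mu>)) x" for x
      using le[of x] by (simp add: count_list_reduced_half(2)[OF s(2)] count_list_conjugate_half)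
  qed
  show "reduced (conjugate_half \<mu>) = reduced \<mu>"
  proof (rule sorted_desc_eqI[OF weak[OF s(2)] weak[OF s(1)]])
    show "count_list (reduced (conjugate_half \<mu>)) x = count_list (reduced \<mu>) x" for x
      using le[of x] by (simp add: count_list_reduced_half(1)[OF s(2)] count_list_conjugate_half)
  qed
qed

lemma conjugate_half_conjugate_half:
  assumes "is_partition \<mu>"
  shows "conjugate_half (conjugate_half \<mu>) = \<mu>"
proof (rule sorted_desc_eqI)
  note p = is_partition_conjugate_half[OF assms]
  show "sorted_wrt (\<ge>) (conjugate_half (conjugate_half \<mu>))" "sorted_wrt (\<ge>) \<mu>"
    using is_partition_conjugate_half[OF p] assms by (auto simp: is_partition_def)
  show "count_list (conjugate_half (conjugate_half \<mu>)) x = count_list \<mu> x" for x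
    using \<open>sorted_wrt (\<ge>) \<mu>\<close>
    by (simp add: count_list_conjugate_half half_conjugate_half[OF assms]
      reduced_conjugate_half[OF assms] conjugate_conjugate[OF is_partition_half[OF assms]]
      count_list_reduced_half)
qed

text \<open>The index depends only on \<delta>, which is kept.\<close>

lemma core_index_conjugate_half:
  "is_partition \<mu> \<Longrightarrow> core_index (conjugate_half \<mu>) = core_index \<mu>"
  by (metis core_index_reduced reduced_conjugate_half)

lemma sum_list_conjugate_half:
  assumes "is_partition \<mu>"
  shows "sum_list (conjugate_half \<mu>) = sum_list \<mu>"
  using arg_cong[OF mset_reduced_half[of \<mu>], of sum_mset]
    sum_list_conjugate[OF is_partition_half[OF assms]]
  by (simp add: conjugate_half_def flip: sum_mset_sum_list)

section \<open>The two statistics\<close>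

text \<open>Counts the columns b-2, b-4, ... that are at least a. With b the length of a row, these
  are the cells of odd arm length.\<close>

lemma card_odd_distances: "card {c. a \<le> c \<and> c < (b :: nat) \<and> odd (b - Suc c)} = (b - a) div 2"
proof -
  have "{c. a \<le> c \<and> c < b \<and> odd (b - Suc c)} = (\<lambda>i. b - 2 * Suc i) ` {..<(b - a) div 2}"
  proof (intro equalityI subsetI)
    fix c
    assume c: "c \<in> {c. a \<le> c \<and> c < b \<and> odd (b - Suc c)}"
    then have "odd (b - Suc c)"
      by blast
    then obtain i where "b - Suc c = 2 * i + 1"
      by (rule oddE)
    with c have "c = b - 2 * Suc i" "i < (b - a) div 2"
      by auto
    then show "c \<in> (\<lambda>i. b - 2 * Suc i) ` {..<(b - a) div 2}"
      by blast
  qed auto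
  moreover have "inj_on (\<lambda>i. b - 2 * Suc i) {..<(b - a) div 2}"
    by (auto simp: inj_on_def)
  ultimately show ?thesis
    by (simp add: card_image)
qed

text \<open>The cells of row \<open>r\<close> with leg 0 are those beyond the end of row
  \<open>Suc r\<close>. Those of odd arm number half the difference of the two rows, rounded down,
  which is the multiplicity of \<open>Suc r\<close> in the halved conjugate.\<close>

lemma h20_eq:
  assumes "is_partition \<mu>"
  shows "h20 \<mu> = length (half (conjugate \<mu>))"
proof -
  let ?n = "length \<mu>" and ?\<nu> = "conjugate \<mu>"
  have arm: "arm \<mu> (r, c) = row \<mu> r - Suc c" for r c
  proof -
    have "{w \<in> diagram \<mu>. fst w = r \<and> c < snd w} = Pair r ` {Suc c..<row \<mu> r}"
      by (auto simp: mem_diagram_iff)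
    then show ?thesis
      by (simp add: arm_def card_image inj_on_def)
  qed
  have leg: "leg \<mu> (r, c) = 0 \<longleftrightarrow> row \<mu> (Suc r) \<le> c" for r c
  proof -
    have "leg \<mu> (r, c) = 0 \<longleftrightarrow> (\<forall>s>r. (s, c) \<notin> diagram \<mu>)"
      by (auto simp: leg_def)
    also have "\<dots> \<longleftrightarrow> row \<mu> (Suc r) \<le> c"
      unfolding mem_diagram_iff not_less
      \<comment> \<open>Rows weakly decrease, so it is enough to test the row directly
        below.\<close>
      by (meson row_antimono[OF assms] Suc_leI le_trans lessI)
    finally show ?thesis .
  qed
  have lt: "r < ?n" if "c < row \<mu> r" for r c
    using row_pos_iff[OF assms, of r] that by linarith
  have "{v \<in> diagram \<mu>. leg \<mu> v = 0 \<and> 2 dvd arm \<mu> v + 1} =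
      (SIGMA r:{..<?n}. {c. row \<mu> (Suc r) \<le> c \<and> c < row \<mu> r \<and> odd (row \<mu> r - Suc c)})"
    by (auto simp: mem_diagram_iff arm leg intro: lt)
  then have "h20 \<mu> =
      (\<Sum>r<?n. card {c. row \<mu> (Suc r) \<le> c \<and> c < row \<mu> r \<and> odd (row \<mu> r - Suc c)})"
    unfolding h20_def by (subst card_SigmaI[symmetric]) auto
  also have "\<dots> = (\<Sum>r<?n. count_list (half ?\<nu>) (Suc r))"
    unfolding card_odd_distances using is_partition_conjugate[OF assms]
    by (simp add: count_list_reduced_half count_list_conjugate[OF assms] is_partition_def)
  also have "\<dots> = (\<Sum>x\<in>Suc ` {..<?n}. count_list (half ?\<nu>) x)"
    by (simp add: sum.reindex)
  also have "\<dots> = length (half ?\<nu>)"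
  proof (rule sum_count_set)
    \<comment> \<open>The sum of multiplicities is the full length because no part of the conjugate
      is 0 or exceeds the number of rows.\<close>
    show "set (half ?\<nu>) \<subseteq> Suc ` {..<?n}"
    proof
      fix x
      assume x: "x \<in> set (half ?\<nu>)"
      then have mem: "x \<in> set ?\<nu>"
        using set_half_subset by blast
      then have "x \<noteq> 0"
        using is_partition_conjugate[OF assms] by (metis is_partition_def)
      then obtain r where r: "x = Suc r"
        using not0_implies_Suc by blast
      have "count_list ?\<nu> (Suc r) \<noteq> 0"
        using mem by (simp add: r count_list_0_iff)
      then have "0 < row \<mu> r"
        by (simp add: count_list_conjugate[OF assms])
      then show "x \<in> Suc ` {..<?n}"
        using row_pos_iff[OF assms] r by simp
    qed
  qed simp
  finally show ?thesis .
qed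

lemma Max_insert_0_eq_row:
  assumes "is_partition \<mu>"
  shows "Max (insert 0 (set \<mu>)) = row \<mu> 0"
proof (cases \<mu>)
  case (Cons x xs)
  with assms show ?thesis
    by (intro Max_eqI) (auto simp: is_partition_def)
qed simp

text \<open>A multiplicity is at least 2 iff its half, rounded down, is nonzero, so the repeated
  parts are the parts of \<kappa>. The largest of them is the number of columns of \<kappa>.\<close>

lemma a2_eq:
  assumes "is_partition \<mu>"
  shows "a2 \<mu> = length (conjugate (half \<mu>))"
proof -
  have "k \<in> set (half \<mu>) \<longleftrightarrow> k \<in> set \<mu> \<and> 2 \<le> count_list \<mu> k" for k
  proof -
    have "k \<in> set (half \<mu>) \<longleftrightarrow> count_list (half \<mu>) k \<noteq> 0"
      by (simp add: count_list_0_iff)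
    also have "\<dots> \<longleftrightarrow> 2 \<le> count_list \<mu> k"
      using assms by (auto simp: count_list_reduced_half is_partition_def)
    also have "\<dots> \<longleftrightarrow> k \<in> set \<mu> \<and> 2 \<le> count_list \<mu> k"
      using count_list_0_iff[of \<mu> k] by auto
    finally show ?thesis .
  qed
  then have "{k \<in> set \<mu>. 2 \<le> count_list \<mu> k} = set (half \<mu>)"
    by blast
  then show ?thesis
    using is_partition_half[OF assms]
    by (simp add: a2_def Max_insert_0_eq_row length_conjugate)
qed

theorem theorem5p11:
  fixes j :: int and n :: nat
  shows "equidistributed_on (partitions_core j n) h20 a2"
proof -
  let ?S = "partitions_core j n" and ?f = "\<lambda>\<mu>. conjugate_half (conjugate \<mu>)"
  have p: "is_partition \<mu>" if "\<mu> \<in> ?S" for \<mu>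
    using that by (simp add: partitions_core_def partitions_def)
  have conj: "conjugate \<mu> \<in> ?S" if "\<mu> \<in> ?S" for \<mu>
    using that p[OF that]
    by (simp add: partitions_core_eq partitions_def is_partition_conjugate core_index_conjugate
      sum_list_conjugate)
  have half: "conjugate_half \<mu> \<in> ?S" if "\<mu> \<in> ?S" for \<mu>
    using that p[OF that]
    by (simp add: partitions_core_eq partitions_def is_partition_conjugate_half
      core_index_conjugate_half sum_list_conjugate_half)
  \<comment> \<open>Both factors are involutions of the set, so the inverse applies them in the
    opposite order.\<close>
  have bij: "bij_betw ?f ?S ?S"
    by (rule bij_betw_byWitness[where f' = "\<lambda>\<mu>. conjugate (conjugate_half \<mu>)"])
       (auto simp: conjugate_half_conjugate_half conjugate_conjugate p conj half)
  have stat: "a2 (?f \<mu>) = h20 \<mu>" if "\<mu> \<in> ?S" for \<mu>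
  proof -
    have q: "is_partition (conjugate \<mu>)"
      using p conj that by blast
    show ?thesis
      \<comment> \<open>The conjugation in \<open>a2_eq\<close> undoes the one in
        \<open>conjugate_half\<close>; both sides become the length of
        \<open>half (conjugate \<mu>)\<close>.\<close>
      by (simp add: a2_eq is_partition_conjugate_half q half_conjugate_half conjugate_conjugate
        is_partition_half h20_eq p that)
  qed
  have "bij_betw ?f {\<mu> \<in> ?S. h20 \<mu> = i} {\<mu> \<in> ?S. a2 \<mu> = i}" for i
    using bij stat by (fastforce simp: bij_betw_def inj_on_def image_iff)
  then show ?thesis
    unfolding equidistributed_on_def using bij_betw_same_card by blast
qed

end
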